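(* Let $S$ be an infinitely distributive inverse semigroup, let $x\in S$, and let $(y_i)_{i\in I}$ be a family of elements of $S$. Assume that the join $\bigvee_i y_i$ exists in $S$, and that the meet $x\wedge\bigvee_i y_i$ exists in $S$. Then for all $i\in I$ the meet $x\wedge y_i$ exists, the join $\bigvee_i (x\wedge y_i)$ exists, and $$x\wedge\bigvee_i y_i=\bigvee_i (x\wedge y_i).$$
   Context: An inverse semigroup $S$ is a semigroup in which every $s$ has a unique inverse $s^{-1}$, i.e. a unique element with $ss^{-1}s=s$ and $s^{-1}ss^{-1}=s^{-1}$. It is partially ordered by its natural order: $s\le t$ iff $s=et$ for some idempotent $e\in S$ (equivalently $s=ss^{-1}t$). All joins $\bigvee$ (least upper bounds) and meets $\wedge$ (greatest lower bounds) are taken in $S$ with respect to this order; they need not exist in general. An inverse semigroup $S$ is infinitely distributive if for every subset $X\subseteq S$ (possibly empty) and every $s\in S$, if $\bigvee X$ exists then $\bigvee (sX)$ exists, where $sX=\{sx\mid x\in X\}$, and $\bigvee(sX)=s\bigvee X$. *)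

theory Defs
  imports "HOL-Library.Lub_Glb"
begin

(* The order is part of the class so that the library's notions of bounds apply to it;
   the axioms for it define it to be the natural order. It is shown below to be a partial order. *)
class inverse_semigroup = semigroup_mult + ord +
  assumes ex1_inverse: "\<exists>!t. s * t * s = s \<and> t * s * t = t"
    and natural_order: "s \<le> t \<longleftrightarrow> (\<exists>e. e * e = e \<and> s = e * t)"
    and natural_order_strict: "s < t \<longleftrightarrow> s \<le> t \<and> \<not> t \<le> s"
begin

lemma idem_mult_idem:
  assumes e: "e * e = e" and f: "f * f = f"
  shows "(e * f) * (e * f) = e * f"
proof -
  obtain x where x: "(e * f) * x * (e * f) = e * f" "x * (e * f) * x = x"
    using ex1_inverse[of "e * f"] by blast
  have ee: "e * (e * z) = e * z" for z using e by (metis mult_assoc)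
  have ff: "f * (f * z) = f * z" for z using f by (metis mult_assoc)
  have x1: "e * (f * (x * (e * f))) = e * f" using x(1) by (simp add: mult_assoc)
  have x2: "x * (e * (f * x)) = x" using x(2) by (simp add: mult_assoc)
  have x2': "x * (e * (f * (x * z))) = x * z" for z
    using x2 by (metis mult_assoc)
  have "(e * f) * (f * x * e) * (e * f) = e * f"
    by (simp add: mult_assoc ee ff x1)
  moreover have "(f * x * e) * (e * f) * (f * x * e) = f * x * e"
    by (simp add: mult_assoc ee ff x2')
  ultimately have xe: "x = f * x * e"
    using ex1_inverse[of "e * f"] x by blast
  have "(f * x * e) * (f * x * e) = f * x * e"
    by (simp add: mult_assoc x2')
  then have xx: "x * x = x" using xe by simp
  have "e * f = x"
    using ex1_inverse[of x] x xx by metis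
  then show ?thesis using xx by simp
qed

lemma idem_commute:
  assumes e: "e * e = e" and f: "f * f = f"
  shows "e * f = f * e"
proof -
  have ef: "e * f * (e * f) = e * f" and fe: "f * e * (f * e) = f * e"
    using idem_mult_idem e f by blast+
  have ee: "e * (e * z) = e * z" for z using e by (metis mult_assoc)
  have ff: "f * (f * z) = f * z" for z using f by (metis mult_assoc)
  have "(e * f) * (f * e) * (e * f) = e * f"
    using ef by (simp add: mult_assoc ee ff)
  moreover have "(f * e) * (e * f) * (f * e) = f * e"
    using fe by (simp add: mult_assoc ee ff)
  moreover have "(e * f) * (e * f) * (e * f) = e * f"
    using ef by simp
  ultimately show ?thesis
    using ex1_inverse[of "e * f"] by blast
qed

subclass order
proof
  fix s t u :: 'a
  show "s < t \<longleftrightarrow> s \<le> t \<and> \<not> t \<le> s"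
    by (rule natural_order_strict)
  show "s \<le> s"
  proof -
    obtain t where t: "s * t * s = s" using ex1_inverse[of s] by blast
    then have "(s * t) * (s * t) = s * t" by (metis mult_assoc)
    then show ?thesis using t natural_order by metis
  qed
  show "s \<le> u" if st: "s \<le> t" and tu: "t \<le> u"
  proof -
    obtain e f where "e * e = e" "s = e * t" "f * f = f" "t = f * u"
      using st tu natural_order by metis
    then show ?thesis using idem_mult_idem[of e f] natural_order mult_assoc by metis
  qed
  show "s = t" if st: "s \<le> t" and ts: "t \<le> s"
  proof -
    obtain e f where ef: "e * e = e" "s = e * t" "f * f = f" "t = f * s"
      using st ts natural_order by metis
    have "t = e * (f * t)"
      using ef idem_commute[of e f] by (metis mult_assoc)
    also have "f * t = t" using ef by (metis mult_assoc)
    finally show ?thesis using ef(2) by simp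
  qed
qed

end

definition has_join :: "'a::order set \<Rightarrow> bool" where
  "has_join X \<longleftrightarrow> (\<exists>j. isLub UNIV X j)"

definition join :: "'a::order set \<Rightarrow> 'a" where
  "join X = (THE j. isLub UNIV X j)"

definition has_meet :: "'a::order \<Rightarrow> 'a \<Rightarrow> bool" where
  "has_meet a b \<longleftrightarrow> (\<exists>m. isGlb UNIV {a, b} m)"

definition meet :: "'a::order \<Rightarrow> 'a \<Rightarrow> 'a" where
  "meet a b = (THE m. isGlb UNIV {a, b} m)"

lemma isLub_unique_order:
  fixes j k :: "'a::order"
  assumes "isLub UNIV X j" "isLub UNIV X k"
  shows "j = k"
  using assms by (meson isLub_isUb isLub_le_isUb order.antisym)

lemma isGlb_unique_order:
  fixes m n :: "'a::order"
  assumes "isGlb UNIV X m" "isGlb UNIV X n"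
  shows "m = n"
  using assms by (meson isGlb_isLb isGlb_le_isLb order.antisym)

lemma isLub_join: "has_join X \<Longrightarrow> isLub UNIV X (join X)"
  unfolding has_join_def join_def by (metis theI isLub_unique_order)

lemma isGlb_meet: "has_meet a b \<Longrightarrow> isGlb UNIV {a, b} (meet a b)"
  unfolding has_meet_def meet_def by (metis theI isGlb_unique_order)

(* The type argument stands for the semigroup: its elements are all elements of the type. X may be empty. *)
definition infinitely_distributive :: "'a::inverse_semigroup itself \<Rightarrow> bool" where
  "infinitely_distributive _ \<longleftrightarrow>
    (\<forall>(X :: 'a set) s. has_join X \<longrightarrow>
      has_join ((\<lambda>x. s * x) ` X) \<and> join ((\<lambda>x. s * x) ` X) = s * join X)"

end

theory Submission
  imports Defs
begin

text \<open>
  Let \<open>Y\<close> be the join of the \<open>y\<^sub>i\<close> and write \<open>x \<and> Y = f Y\<close> with \<open>f\<close> idempotent.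
  Since idempotents commute, \<open>x \<and> y = f y\<close> for every \<open>y \<le> Y\<close>, so the claim is
  infinite distributivity applied to left multiplication by \<open>f\<close>.
\<close>

lemma isGlb_pair_iff:
  "isGlb UNIV {a, b} m \<longleftrightarrow> m \<le> a \<and> m \<le> b \<and> (\<forall>z. z \<le> a \<longrightarrow> z \<le> b \<longrightarrow> z \<le> m)"
  for m :: "'a::order"
  by (auto simp: isGlb_def greatestP_def isLb_def setge_def setle_def)

lemma meet_equality: "meet a b = m" if "isGlb UNIV {a, b} m" for m :: "'a::order"
  using that isGlb_meet isGlb_unique_order unfolding has_meet_def by blast

lemma idem_mult_le:
  fixes e s :: "'a::inverse_semigroup"
  assumes "e * e = e"
  shows "e * s \<le> s"
  using assms natural_order by blast

lemma idem_mult_left_commute: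
  fixes e f s :: "'a::inverse_semigroup"
  assumes "e * e = e" "f * f = f"
  shows "e * (f * s) = f * (e * s)"
  by (metis assms idem_commute mult.assoc)

text \<open>If \<open>y = e * Y\<close>, commuting idempotents turn \<open>f * y\<close> into
  \<open>e * (f * Y)\<close>, which lies below \<open>x\<close>. Conversely, a lower bound of
  \<open>x\<close> and \<open>y\<close> is one of \<open>x\<close> and \<open>Y\<close>, so it lies
  below \<open>f * Y\<close>.\<close>

lemma isGlb_idem_mult:
  fixes x y Y f :: "'a::inverse_semigroup"
  assumes f: "f * f = f" and glb: "isGlb UNIV {x, Y} (f * Y)" and "y \<le> Y"
  shows "isGlb UNIV {x, y} (f * y)"
  unfolding isGlb_pair_iff
proof (intro conjI allI impI)
  obtain e where e: "e * e = e" "y = e * Y"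
    using \<open>y \<le> Y\<close> natural_order by blast
  have "f * y = e * (f * Y)"
    using e f by (simp add: idem_mult_left_commute)
  also have "\<dots> \<le> f * Y" using e(1) by (rule idem_mult_le)
  also have "\<dots> \<le> x" using glb by (simp add: isGlb_pair_iff)
  finally show "f * y \<le> x" .
  show "f * y \<le> y" using f by (rule idem_mult_le)
next
  fix z assume "z \<le> x" "z \<le> y"
  then have "z \<le> f * Y"
    using glb \<open>y \<le> Y\<close> by (meson isGlb_pair_iff order_trans)
  then obtain h where h: "h * h = h" "z = h * (f * Y)"
    using natural_order by blast
  obtain g where g: "g * g = g" "z = g * y"
    using \<open>z \<le> y\<close> natural_order by blast
  \<comment> \<open>In \<open>z = h * (f * Y)\<close> the factor \<open>f\<close> can be moved to
    the front, so \<open>f\<close> fixes \<open>z\<close>; multiplying \<open>z = g * y\<close> by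
    \<open>f\<close> then brings \<open>z\<close> below \<open>f * y\<close>.\<close>
  have "z = f * z"
    using h f by (metis idem_mult_left_commute mult.assoc)
  also have "\<dots> = g * (f * y)"
    using g f by (simp add: idem_mult_left_commute)
  also have "\<dots> \<le> f * y" using g(1) by (rule idem_mult_le)
  finally show "z \<le> f * y" .
qed

theorem mainTheorem1:
  fixes x :: "'a::inverse_semigroup"
    and y :: "'i \<Rightarrow> 'a"
    and I :: "'i set"
  assumes "infinitely_distributive TYPE('a)"
    and "has_join (y ` I)"
    and "has_meet x (join (y ` I))"
  shows "(\<forall>i\<in>I. has_meet x (y i))
    \<and> has_join ((\<lambda>i. meet x (y i)) ` I)
    \<and> meet x (join (y ` I)) = join ((\<lambda>i. meet x (y i)) ` I)"
proof -
  let ?Y = "join (y ` I)"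
  have glb: "isGlb UNIV {x, ?Y} (meet x ?Y)"
    using assms(3) by (rule isGlb_meet)
  then have "meet x ?Y \<le> ?Y" by (simp add: isGlb_pair_iff)
  then obtain f where f: "f * f = f" "meet x ?Y = f * ?Y"
    using natural_order by blast
  have "y i \<le> ?Y" if "i \<in> I" for i
    using isLub_join[OF assms(2)] that by (meson imageI isLubD2)
  then have glb_i: "isGlb UNIV {x, y i} (f * y i)" if "i \<in> I" for i
    using isGlb_idem_mult f glb that by metis
  \<comment> \<open>The same \<open>f\<close> serves every index, so the meets form a single left
    translate by \<open>f\<close> of the family, as infinite distributivity requires.\<close>
  then have eq: "(\<lambda>i. meet x (y i)) ` I = (\<lambda>s. f * s) ` y ` I"
    unfolding image_image by (intro image_cong refl meet_equality)
  \<comment> \<open>Distributivity yields the join \<open>f * ?Y\<close>, which is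
    \<open>meet x ?Y\<close> by the choice of \<open>f\<close>.\<close>
  show ?thesis
    using assms(1,2) glb_i f(2) unfolding eq infinitely_distributive_def has_meet_def
    by metis
qed

end
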